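(* Work in the "linear" axiomatic framework for three-dimensional projective space described in the context (a set $\mathbb{L}$ of lines with an incidence relation $\sim$ satisfying Axioms [1]–[4]). Let $o, p, q, r \in \mathbb{L}$ be four pairwise-incident lines, and suppose that some three of them form a plane-triad. Then $o, p, q, r$ are coplanar (all four lie in one plane $\mathrm{pl}(x,y)$ for some incident pair of distinct lines $x, y$), and no three of them form a point-triad.
   Context: Let $\mathbb{L}$ be a set (whose elements are called lines) with a symmetric reflexive relation $\sim$ (incidence). Lines that are not incident are called skew. For $S \subseteq \mathbb{L}$ let $S^{\sim}$ be the set of all lines incident to every line of $S$, and write $[l_1 \dots l_n] = \{l_1,\dots,l_n\}^{\sim}$. The axioms are: Axiom [1]: for each line $l$, the set $\{l\}^{\sim}$ contains three pairwise skew lines. Axiom [2]: for each incident pair of distinct lines $a,b$: (2.1) $[ab]$ contains skew pairs of lines; (2.2) if $c \in [ab]\setminus[ab]^{\sim}$ is one of such a skew pair, then no skew pairs lie in $[abc]$; (2.3) if $x,y$ is a skew pair in $[ab]$ then $[ab] = [abx]\cup[aby]$. Axiom [3]: if $a,b$ is an incident line pair and $c \in [ab]\setminus[ab]^{\sim}$, then there exist an incident line pair $p,q$ and $r \in [pq]\setminus[pq]^{\sim}$ with $[abc]\cap[pqr]=\emptyset$. For incident distinct lines $a,b$ put $\Sigma(a,b) = [ab]\setminus[ab]^{\sim}$; incidence restricted to $\Sigma(a,b)$ is an equivalence relation with exactly two classes, which (as part of the structure) are labelled $\Sigma_{\mathrm{pt}}(a,b)$ and $\Sigma_{\mathrm{pl}}(a,b)$.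 The point $\mathrm{pt}(a,b) = [abc]$ with $c \in \Sigma_{\mathrm{pt}}(a,b)$ and the plane $\mathrm{pl}(a,b) = [abc]$ with $c \in \Sigma_{\mathrm{pl}}(a,b)$ are independent of the choice of $c$. Axiom [4]: whenever $a,b$ and $p,q$ are pairs of distinct incident lines, $\mathrm{pt}(a,b)\cap\mathrm{pt}(p,q)\neq\emptyset$ and $\mathrm{pl}(a,b)\cap\mathrm{pl}(p,q)\neq\emptyset$. A triad is a triple of pairwise-incident lines $a,b,c$ with $c \in \Sigma(a,b)$ (equivalently $a\in\Sigma(b,c)$, equivalently $b \in \Sigma(c,a)$). It is a plane-triad if $a\in\Sigma_{\mathrm{pl}}(b,c)$, $b\in\Sigma_{\mathrm{pl}}(c,a)$, $c\in\Sigma_{\mathrm{pl}}(a,b)$, and a point-triad if the same holds with $\mathrm{pt}$ in place of $\mathrm{pl}$; every triad is of exactly one of these two types. Lines are coplanar if they all lie in one plane $\mathrm{pl}(x,y)$ for some incident distinct $x,y$. *)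

theory Defs
  imports Main
begin

text \<open>The two families \<open>Sig_pt\<close> and \<open>Sig_pl\<close> are the labelling of the two incidence classes in
  \<open>Sig a b\<close>; their values matter only at pairs of distinct incident lines.\<close>

locale line_structure =
  fixes L :: "'a set"
    and inc :: "'a \<Rightarrow> 'a \<Rightarrow> bool"
    and Sig_pt :: "'a \<Rightarrow> 'a \<Rightarrow> 'a set"
    and Sig_pl :: "'a \<Rightarrow> 'a \<Rightarrow> 'a set"
begin

definition perp :: "'a set \<Rightarrow> 'a set" where
  "perp S = {l \<in> L. \<forall>s\<in>S. inc l s}"

abbreviation skew :: "'a \<Rightarrow> 'a \<Rightarrow> bool" where
  "skew x y \<equiv> \<not> inc x y"

definition incident_pair :: "'a \<Rightarrow> 'a \<Rightarrow> bool" where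
  "incident_pair a b \<longleftrightarrow> a \<in> L \<and> b \<in> L \<and> a \<noteq> b \<and> inc a b"

definition Sig :: "'a \<Rightarrow> 'a \<Rightarrow> 'a set" where
  "Sig a b = perp {a, b} - perp (perp {a, b})"

text \<open>The result does not depend on the chosen line \<open>c\<close>; see \<open>pt_eq\<close> and \<open>pl_eq\<close> below.\<close>

definition pt :: "'a \<Rightarrow> 'a \<Rightarrow> 'a set" where
  "pt a b = perp {a, b, SOME c. c \<in> Sig_pt a b}"

definition pl :: "'a \<Rightarrow> 'a \<Rightarrow> 'a set" where
  "pl a b = perp {a, b, SOME c. c \<in> Sig_pl a b}"

definition triad :: "'a \<Rightarrow> 'a \<Rightarrow> 'a \<Rightarrow> bool" where
  "triad a b c \<longleftrightarrow>
     incident_pair a b \<and> incident_pair b c \<and> incident_pair c a \<and> c \<in> Sig a b"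

definition plane_triad :: "'a \<Rightarrow> 'a \<Rightarrow> 'a \<Rightarrow> bool" where
  "plane_triad a b c \<longleftrightarrow>
     triad a b c \<and> a \<in> Sig_pl b c \<and> b \<in> Sig_pl c a \<and> c \<in> Sig_pl a b"

definition point_triad :: "'a \<Rightarrow> 'a \<Rightarrow> 'a \<Rightarrow> bool" where
  "point_triad a b c \<longleftrightarrow>
     triad a b c \<and> a \<in> Sig_pt b c \<and> b \<in> Sig_pt c a \<and> c \<in> Sig_pt a b"

definition coplanar :: "'a set \<Rightarrow> bool" where
  "coplanar S \<longleftrightarrow> (\<exists>x y. incident_pair x y \<and> S \<subseteq> pl x y)"

end

locale line_space = line_structure L inc Sig_pt Sig_pl
  for L :: "'a set"
    and inc :: "'a \<Rightarrow> 'a \<Rightarrow> bool"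
    and Sig_pt :: "'a \<Rightarrow> 'a \<Rightarrow> 'a set"
    and Sig_pl :: "'a \<Rightarrow> 'a \<Rightarrow> 'a set" +
  assumes inc_refl: "x \<in> L \<Longrightarrow> inc x x"
    and inc_sym: "\<lbrakk>x \<in> L; y \<in> L; inc x y\<rbrakk> \<Longrightarrow> inc y x"
    and axiom1: "l \<in> L \<Longrightarrow>
      \<exists>x\<in>perp {l}. \<exists>y\<in>perp {l}. \<exists>z\<in>perp {l}. skew x y \<and> skew y z \<and> skew x z"
    and axiom2_1: "incident_pair a b \<Longrightarrow> \<exists>x\<in>perp {a, b}. \<exists>y\<in>perp {a, b}. skew x y"
    and axiom2_2: "\<lbrakk>incident_pair a b; c \<in> Sig a b; d \<in> perp {a, b}; skew c d\<rbrakk> \<Longrightarrow>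
      \<not> (\<exists>x\<in>perp {a, b, c}. \<exists>y\<in>perp {a, b, c}. skew x y)"
    and axiom2_3: "\<lbrakk>incident_pair a b; x \<in> perp {a, b}; y \<in> perp {a, b}; skew x y\<rbrakk> \<Longrightarrow>
      perp {a, b} = perp {a, b, x} \<union> perp {a, b, y}"
    and axiom3: "\<lbrakk>incident_pair a b; c \<in> Sig a b\<rbrakk> \<Longrightarrow>
      \<exists>p q r. incident_pair p q \<and> r \<in> Sig p q \<and> perp {a, b, c} \<inter> perp {p, q, r} = {}"
    and labelling: "incident_pair a b \<Longrightarrow>
      Sig a b // {(x, y). x \<in> Sig a b \<and> y \<in> Sig a b \<and> inc x y} = {Sig_pt a b, Sig_pl a b}"
    and labels_distinct: "incident_pair a b \<Longrightarrow> Sig_pt a b \<noteq> Sig_pl a b"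
    and axiom4_pt: "\<lbrakk>incident_pair a b; incident_pair p q\<rbrakk> \<Longrightarrow> pt a b \<inter> pt p q \<noteq> {}"
    and axiom4_pl: "\<lbrakk>incident_pair a b; incident_pair p q\<rbrakk> \<Longrightarrow> pl a b \<inter> pl p q \<noteq> {}"
begin

lemma not_skew_in_span:
  assumes "incident_pair a b" "c \<in> Sig a b" "x \<in> perp {a, b, c}" "y \<in> perp {a, b, c}"
  shows "inc x y"
proof -
  obtain d where "d \<in> perp {a, b}" "skew c d"
    using assms(2) by (auto simp: Sig_def perp_def)
  then show ?thesis using axiom2_2 assms by blast
qed

lemma Sig_equiv:
  assumes ab: "incident_pair a b"
  shows "equiv (Sig a b) {(x, y). x \<in> Sig a b \<and> y \<in> Sig a b \<and> inc x y}"
proof (rule equivI)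
  show "refl_on (Sig a b) {(x, y). x \<in> Sig a b \<and> y \<in> Sig a b \<and> inc x y}"
    by (auto simp: refl_on_def Sig_def perp_def intro: inc_refl)
  show "sym {(x, y). x \<in> Sig a b \<and> y \<in> Sig a b \<and> inc x y}"
    by (auto simp: sym_def Sig_def perp_def intro: inc_sym)
  show "trans {(x, y). x \<in> Sig a b \<and> y \<in> Sig a b \<and> inc x y}"
  proof (rule transI, clarsimp)
    fix x y z assume s: "x \<in> Sig a b" "y \<in> Sig a b" "z \<in> Sig a b" "inc x y" "inc y z"
    then have "x \<in> perp {a, b, y}" "z \<in> perp {a, b, y}"
      using inc_sym by (auto simp: Sig_def perp_def)
    then show "inc x z" using not_skew_in_span ab s(2) by blast
  qed
qed (auto)

lemma span_eq:
  assumes "incident_pair a b" "c \<in> Sig a b" "d \<in> Sig a b" "inc c d"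
  shows "perp {a, b, c} = perp {a, b, d}"
proof -
  have *: "perp {a, b, c} \<subseteq> perp {a, b, d}"
    if cd: "c \<in> Sig a b" "d \<in> Sig a b" "inc c d" for c d
  proof
    fix l assume l: "l \<in> perp {a, b, c}"
    have "d \<in> perp {a, b, c}"
      using cd inc_sym by (auto simp: Sig_def perp_def)
    then have "inc l d" using not_skew_in_span assms(1) cd(1) l by blast
    then show "l \<in> perp {a, b, d}" using l by (auto simp: perp_def)
  qed
  have "inc d c" using assms inc_sym by (auto simp: Sig_def perp_def)
  then show ?thesis using * assms by blast
qed

lemma class_props:
  assumes "incident_pair a b" "S \<in> {Sig_pt a b, Sig_pl a b}"
  shows "S \<noteq> {}" "S \<subseteq> Sig a b" "\<And>c d. \<lbrakk>c \<in> S; d \<in> S\<rbrakk> \<Longrightarrow> inc c d"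
proof -
  let ?R = "{(x, y). x \<in> Sig a b \<and> y \<in> Sig a b \<and> inc x y}"
  have S: "S \<in> Sig a b // ?R" using labelling assms by simp
  show "S \<noteq> {}" using in_quotient_imp_non_empty[OF Sig_equiv[OF assms(1)] S] .
  show "S \<subseteq> Sig a b" using in_quotient_imp_subset[OF Sig_equiv[OF assms(1)] S] .
  show "inc c d" if "c \<in> S" "d \<in> S" for c d
    using in_quotient_imp_in_rel[OF Sig_equiv[OF assms(1)] S, of c d] that by auto
qed

lemma pt_eq:
  assumes "incident_pair a b" "c \<in> Sig_pt a b"
  shows "pt a b = perp {a, b, c}"
proof -
  have "(SOME c. c \<in> Sig_pt a b) \<in> Sig_pt a b" using assms(2) by (rule someI)
  then show ?thesis
    using span_eq[OF assms(1)] class_props[OF assms(1), of "Sig_pt a b"] assms(2)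
    unfolding pt_def by blast
qed

lemma pl_eq:
  assumes "incident_pair a b" "c \<in> Sig_pl a b"
  shows "pl a b = perp {a, b, c}"
proof -
  have "(SOME c. c \<in> Sig_pl a b) \<in> Sig_pl a b" using assms(2) by (rule someI)
  then show ?thesis
    using span_eq[OF assms(1)] class_props[OF assms(1), of "Sig_pl a b"] assms(2)
    unfolding pl_def by blast
qed

end

end

theory Submission
  imports Defs
begin

text \<open>A span \<open>perp {x, y, z}\<close> with \<open>z \<in> Sig x y\<close> consists of pairwise incident lines. So if a
  plane-triad and a point-triad are mutually incident, each lies in the span of the other and the
  two spans coincide: one set of lines is both a plane and a point. By axiom 4 it then meets every
  plane and every point, contrary to axiom 3.\<close>

context line_space
begin

lemma Sig_eq_Un:
  assumes "incident_pair a b"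
  shows "Sig a b = Sig_pt a b \<union> Sig_pl a b"
  using Union_quotient[OF Sig_equiv[OF assms]] labelling[OF assms] by auto

text \<open>Axiom 3 supplies a span without a label, while axiom 4 speaks of points and planes. This
  lemma connects the two.\<close>

lemma span_cases:
  assumes "incident_pair a b" "c \<in> Sig a b"
  shows "perp {a, b, c} = pt a b \<or> perp {a, b, c} = pl a b"
proof -
  have "c \<in> Sig_pt a b \<or> c \<in> Sig_pl a b"
    using assms Sig_eq_Un by auto
  then show ?thesis
    using pt_eq[OF assms(1)] pl_eq[OF assms(1)] by metis
qed

lemma pt_neq_pl:
  assumes "incident_pair a b" "incident_pair c d"
  shows "pt a b \<noteq> pl c d"
proof
  assume eq: "pt a b = pl c d"
  obtain e where e: "e \<in> Sig_pt a b" "e \<in> Sig a b"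
    using class_props(1,2)[OF assms(1), of "Sig_pt a b"] by blast
  obtain p q r where pqr: "incident_pair p q" "r \<in> Sig p q"
    and disj: "pt a b \<inter> perp {p, q, r} = {}"
    using axiom3[OF assms(1) e(2)] pt_eq[OF assms(1) e(1)] by auto
  \<comment> \<open>The first claim uses the set as the point \<open>pt a b\<close>, the second as
    the plane \<open>pl c d\<close>.\<close>
  have "pt a b \<inter> pt p q \<noteq> {}" "pt a b \<inter> pl p q \<noteq> {}"
    using axiom4_pt[OF assms(1) pqr(1)] axiom4_pl[OF assms(2) pqr(1)] eq by auto
  then show False using span_cases[OF pqr] disj by auto
qed

text \<open>By axiom 2.2 the span of a triad contains no skew pair, so each of its lines is incident
  to any three lines chosen from it.\<close>

lemma span_mono:
  assumes "triad x y z" "{u, v, w} \<subseteq> perp {x, y, z}"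
  shows "perp {x, y, z} \<subseteq> perp {u, v, w}"
proof
  fix l assume l: "l \<in> perp {x, y, z}"
  have "inc l s" if "s \<in> {u, v, w}" for s
    using not_skew_in_span[of x y z l s] assms l that unfolding triad_def by blast
  then show "l \<in> perp {u, v, w}" using l unfolding perp_def by blast
qed

lemma plane_triad_not_incident_point_triad:
  assumes "plane_triad x y z" "point_triad u v w"
    and "\<forall>s\<in>{x, y, z}. \<forall>t\<in>{u, v, w}. inc s t"
  shows False
proof -
  have t: "triad x y z" "triad u v w" and c: "z \<in> Sig_pl x y" "w \<in> Sig_pt u v"
    using assms(1,2) by (auto simp: plane_triad_def point_triad_def)
  have ip: "incident_pair x y" "incident_pair u v"
    using t by (auto simp: triad_def)
  have L: "{x, y, z, u, v, w} \<subseteq> L"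
    using t by (auto simp: triad_def incident_pair_def)
  \<comment> \<open>The second inclusion is the incidence hypothesis as it stands; the first needs
    it reversed by symmetry.\<close>
  have "{u, v, w} \<subseteq> perp {x, y, z}" "{x, y, z} \<subseteq> perp {u, v, w}"
    unfolding perp_def using L assms(3) inc_sym by blast+
  then have "perp {x, y, z} = perp {u, v, w}"
    by (intro equalityI span_mono[OF t(1)] span_mono[OF t(2)])
  \<comment> \<open>The label of \<open>z\<close> makes the common span a plane, that of
    \<open>w\<close> makes it a point.\<close>
  then show False
    using pl_eq[OF ip(1) c(1)] pt_eq[OF ip(2) c(2)] pt_neq_pl[OF ip(2,1)] by simp
qed

text \<open>The span of a plane-triad is itself a plane, and it contains every line incident to all
  three members.\<close>

lemma coplanar_if_plane_triad:
  assumes "plane_triad x y z" "S \<subseteq> L" "\<forall>s\<in>S. \<forall>t\<in>{x, y, z}. inc s t"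
  shows "coplanar S"
proof -
  have ip: "incident_pair x y" and c: "z \<in> Sig_pl x y"
    using assms(1) by (auto simp: plane_triad_def triad_def)
  have "S \<subseteq> pl x y"
    unfolding pl_eq[OF ip c] using assms(2,3) by (auto simp: perp_def)
  then show ?thesis using ip by (auto simp: coplanar_def)
qed

text \<open>An arbitrary set \<open>S\<close> avoids cases on which of the four lines form each
  triad. The two triads may share lines, since incidence on \<open>S\<close> includes that of a line
  with itself.\<close>

lemma coplanar_no_point_triad:
  assumes "S \<subseteq> L" "\<forall>s\<in>S. \<forall>t\<in>S. inc s t" "\<exists>x\<in>S. \<exists>y\<in>S. \<exists>z\<in>S. plane_triad x y z"
  shows "coplanar S \<and> \<not> (\<exists>x\<in>S. \<exists>y\<in>S. \<exists>z\<in>S. point_triad x y z)"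
proof -
  obtain x y z where xyz: "{x, y, z} \<subseteq> S" "plane_triad x y z"
    using assms(3) by auto
  have "coplanar S"
    by (rule coplanar_if_plane_triad[OF xyz(2) assms(1)]) (use xyz(1) assms(2) in auto)
  moreover have "\<not> point_triad u v w" if "{u, v, w} \<subseteq> S" for u v w
  proof
    assume pt: "point_triad u v w"
    have "\<forall>s\<in>{x, y, z}. \<forall>t\<in>{u, v, w}. inc s t"
      using xyz(1) that assms(2) by auto
    then show False by (rule plane_triad_not_incident_point_triad[OF xyz(2) pt])
  qed
  ultimately show ?thesis by auto
qed

end

theorem theorem1:
  fixes L :: "'a set"
    and inc :: "'a \<Rightarrow> 'a \<Rightarrow> bool"
    and Sig_pt Sig_pl :: "'a \<Rightarrow> 'a \<Rightarrow> 'a set"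
    and o' p q r :: 'a
  assumes "line_space L inc Sig_pt Sig_pl"
    and "{o', p, q, r} \<subseteq> L"
    and "\<forall>x\<in>{o', p, q, r}. \<forall>y\<in>{o', p, q, r}. inc x y"
    and "\<exists>x\<in>{o', p, q, r}. \<exists>y\<in>{o', p, q, r}. \<exists>z\<in>{o', p, q, r}.
           line_structure.plane_triad L inc Sig_pl x y z"
  shows "line_structure.coplanar L inc Sig_pl {o', p, q, r} \<and>
         \<not> (\<exists>x\<in>{o', p, q, r}. \<exists>y\<in>{o', p, q, r}. \<exists>z\<in>{o', p, q, r}.
              line_structure.point_triad L inc Sig_pt x y z)"
proof -
  interpret line_space L inc Sig_pt Sig_pl by (fact assms(1))
  show ?thesis by (rule coplanar_no_point_triad[OF assms(2-4)])
qed

end
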